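(* Let $\mathcal{M}=(S,\mathcal{A},\mathcal{P},s_0)$ be a finite MDP with observed states $W\subseteq S$, a set $C_{reach}\subseteq S$ all of whose states are absorbing and unobserved, and a threshold $\nu_{reach}\in[0,1]$, and assume that all unobserved maximal end components of $\mathcal{M}$ are closed. Then the following optimization problem, with real decision variables $x_{s,a}$ for $s\in S\setminus C_{end}$, $a\in\mathcal{A}(s)$, is a convex optimization problem (i.e. its extended-real-valued objective is a convex function on the set where all $x_{s,a}\ge0$, and its constraints are affine equalities and inequalities): \begin{align*} \inf\ & \sum_{w\in W}F_w\big((x_{w,a})_{a\in\mathcal{A}(w)}\big)\\ \text{s.t. } & x_{s,a}\ge 0 \quad \forall s\in S\setminus C_{end},\ \forall a\in\mathcal{A}(s),\\ & \sum_{a\in\mathcal{A}(s)}x_{s,a}-\sum_{q\in S\setminus C_{end}}\sum_{a\in\mathcal{A}(q)}x_{q,a}\mathcal{P}_{q,a,s}=\mathds{1}_{s_0}(s)\quad\forall s\in S\setminus C_{end},\\ & \sum_{q\in C_{reach}}\Big(\mathds{1}_{s_0}(q)+\sum_{s\in S\setminus C_{end}}\sum_{a\in\mathcal{A}(s)}x_{s,a}\mathcal{P}_{s,a,q}\Big)\ge\nu_{reach}. \end{align*}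
   Context: An MDP has finite state set $S$, finite action set $\mathcal{A}$, available actions $\mathcal{A}(s)$, transition probabilities $\mathcal{P}_{s,a,q}$ with $\sum_{q}\mathcal{P}_{s,a,q}=1$ for $a\in\mathcal{A}(s)$, and initial state $s_0$. $Succ(s)=\{q:\exists a\in\mathcal{A}(s),\ \mathcal{P}_{s,a,q}>0\}$. A state $s$ is absorbing if $\mathcal{P}_{s,a,s}=1$ for all $a\in\mathcal{A}(s)$. $\mathds{1}_{s_0}(s)=1$ if $s=s_0$ and $0$ otherwise. A sub-MDP $(C,D)$ consists of a non-empty $C\subseteq S$ and a map $D$ assigning to each $s\in C$ a non-empty set $D(s)\subseteq\mathcal{A}(s)$ such that $a\in D(s)$ only if $\mathcal{P}_{s,a,q}=0$ for all $q\notin C$. It is an unobserved end component (UEC) if the digraph induced by $(C,D)$ is strongly connected and $C\cap W=\emptyset$. An unobserved maximal end component (UMEC) is a UEC $(C,D)$ for which no other UEC $(C',D')\neq(C,D)$ satisfies $C\subseteq C'$ and $D(s)\subseteq D'(s)$ for all $s\in C$. It is closed if $Succ(s)\subseteq C$ for all $s\in C$. $C_{end}$ is the set of states belonging to some UMEC (so $C_{end}\cap W=\emptyset$). The function $F_w$ is the expected total information $x_w\iota_w$ of $w$ expressed in the expected state-action residence times $x_{w,a}\ge0$: writing $x_w=\sum_{a\in\mathcal{A}(w)}x_{w,a}$ and, if $x_w>0$, $p_q=\frac{1}{x_w}\sum_{a\in\mathcal{A}(w)}x_{w,a}\mathcal{P}_{w,a,q}$ for $q\in Succ(w)$, set $F_w=0$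 if $x_w=0$; $F_w=\infty$ if $x_w>0$ and $p_q=1$ for some $q$; and $F_w=x_w\big(\sum_{q\in Succ(w)}p_q(1-p_q)\big)^{-1}$ otherwise. *)

theory Defs
  imports "HOL-Analysis.Analysis" "Graph_Theory.Digraph_Component"
begin

text \<open>\<open>Eq l r\<close> stands for the constraint \<open>l x = r x\<close>, and \<open>Geq l r\<close> for \<open>l x \<ge> r x\<close>.\<close>

datatype 'v constraint =
    Eq "'v \<Rightarrow> real" "'v \<Rightarrow> real"
  | Geq "'v \<Rightarrow> real" "'v \<Rightarrow> real"

fun satisfies :: "'v \<Rightarrow> 'v constraint \<Rightarrow> bool" where
  "satisfies x (Eq l r) \<longleftrightarrow> l x = r x"
| "satisfies x (Geq l r) \<longleftrightarrow> l x \<ge> r x"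

text \<open>\<open>dom\<close> is the set on which the objective, which is to be minimized, is considered.\<close>

record 'v opt_problem =
  dom :: "'v set"
  objective :: "'v \<Rightarrow> ereal"
  constraints :: "'v constraint set"

definition feasible_set :: "'v opt_problem \<Rightarrow> 'v set" where
  "feasible_set Q = {x \<in> dom Q. \<forall>c \<in> constraints Q. satisfies x c}"

definition optimal_value :: "'v opt_problem \<Rightarrow> ereal" where
  "optimal_value Q = (INF x \<in> feasible_set Q. objective Q x)"

definition affine_function :: "('v::real_vector \<Rightarrow> real) \<Rightarrow> bool" where
  "affine_function f \<longleftrightarrow> (\<exists>L c. linear L \<and> (\<forall>x. f x = L x + c))"

fun affine_constraint :: "'v::real_vector constraint \<Rightarrow> bool" where
  "affine_constraint (Eq l r) \<longleftrightarrow> affine_function l \<and> affine_function r"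
| "affine_constraint (Geq l r) \<longleftrightarrow> affine_function l \<and> affine_function r"

text \<open>
  The extended-real analogue of \<open>convex_on\<close>. It is used for objectives that are nonnegative on
  \<open>S\<close>, so no sum of opposite infinities occurs; at \<open>u = 0\<close> the convention \<open>0 * \<infinity> = 0\<close> makes the
  inequality trivial.
\<close>

definition ereal_convex_on :: "'v::real_vector set \<Rightarrow> ('v \<Rightarrow> ereal) \<Rightarrow> bool" where
  "ereal_convex_on S f \<longleftrightarrow> convex S \<and>
    (\<forall>x\<in>S. \<forall>y\<in>S. \<forall>u\<ge>0. \<forall>v\<ge>0. u + v = 1 \<longrightarrow>
       f (u *\<^sub>R x + v *\<^sub>R y) \<le> ereal u * f x + ereal v * f y)"

definition convex_problem :: "'v::real_vector opt_problem \<Rightarrow> bool" where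
  "convex_problem Q \<longleftrightarrow>
     ereal_convex_on (dom Q) (objective Q) \<and>
     finite (constraints Q) \<and>
     (\<forall>c \<in> constraints Q. affine_constraint c)"


text \<open>
  The state set is the whole type \<open>'s\<close>. The values \<open>trans M s a q\<close> are meaningful only for
  \<open>a \<in> avail M s\<close>.
\<close>

record ('s, 'a) mdp =
  avail :: "'s \<Rightarrow> 'a set"
  trans :: "'s \<Rightarrow> 'a \<Rightarrow> 's \<Rightarrow> real"
  init :: 's

definition is_mdp :: "('s::finite, 'a::finite) mdp \<Rightarrow> bool" where
  "is_mdp M \<longleftrightarrow>
     (\<forall>s. \<forall>a \<in> avail M s. (\<forall>q. 0 \<le> trans M s a q) \<and> (\<Sum>q\<in>UNIV. trans M s a q) = 1)"

definition Succ :: "('s, 'a) mdp \<Rightarrow> 's \<Rightarrow> 's set" where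
  "Succ M s = {q. \<exists>a \<in> avail M s. trans M s a q > 0}"

definition absorbing :: "('s, 'a) mdp \<Rightarrow> 's \<Rightarrow> bool" where
  "absorbing M s \<longleftrightarrow> (\<forall>a \<in> avail M s. trans M s a s = 1)"

text \<open>
  Action maps are extensional on \<open>C\<close>, so that equality of the pairs \<open>(C, D)\<close> is equality of
  sub-MDPs.
\<close>

definition sub_mdp :: "('s, 'a) mdp \<Rightarrow> 's set \<Rightarrow> ('s \<Rightarrow> 'a set) \<Rightarrow> bool" where
  "sub_mdp M C D \<longleftrightarrow>
     C \<noteq> {} \<and>
     D \<in> (\<Pi>\<^sub>E s\<in>C. {B. B \<noteq> {} \<and> B \<subseteq> avail M s}) \<and>
     (\<forall>s\<in>C. \<forall>a \<in> D s. \<forall>q. q \<notin> C \<longrightarrow> trans M s a q = 0)"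

definition induced_digraph ::
    "('s, 'a) mdp \<Rightarrow> 's set \<Rightarrow> ('s \<Rightarrow> 'a set) \<Rightarrow> 's pair_pre_digraph" where
  "induced_digraph M C D =
     \<lparr>pverts = C, parcs = {(s, q). s \<in> C \<and> q \<in> C \<and> (\<exists>a \<in> D s. trans M s a q > 0)}\<rparr>"

definition uec :: "('s, 'a) mdp \<Rightarrow> 's set \<Rightarrow> 's set \<Rightarrow> ('s \<Rightarrow> 'a set) \<Rightarrow> bool" where
  "uec M W C D \<longleftrightarrow>
     sub_mdp M C D \<and> strongly_connected (with_proj (induced_digraph M C D)) \<and> C \<inter> W = {}"

definition umec :: "('s, 'a) mdp \<Rightarrow> 's set \<Rightarrow> 's set \<Rightarrow> ('s \<Rightarrow> 'a set) \<Rightarrow> bool" where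
  "umec M W C D \<longleftrightarrow>
     uec M W C D \<and>
     \<not> (\<exists>C' D'. uec M W C' D' \<and> (C', D') \<noteq> (C, D) \<and> C \<subseteq> C' \<and> (\<forall>s\<in>C. D s \<subseteq> D' s))"

definition closed_component :: "('s, 'a) mdp \<Rightarrow> 's set \<Rightarrow> bool" where
  "closed_component M C \<longleftrightarrow> (\<forall>s\<in>C. Succ M s \<subseteq> C)"

definition C_end :: "('s, 'a) mdp \<Rightarrow> 's set \<Rightarrow> 's set" where
  "C_end M W = {s. \<exists>C D. umec M W C D \<and> s \<in> C}"


text \<open>
  In the next three definitions \<open>y $ a\<close> is the expected residence time of the pair \<open>(w, a)\<close>;
  only the entries with \<open>a \<in> avail M w\<close> are used.
\<close>

definition residence :: "('s, 'a::finite) mdp \<Rightarrow> 's \<Rightarrow> real ^ 'a \<Rightarrow> real" where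
  "residence M w y = (\<Sum>a \<in> avail M w. y $ a)"

definition succ_prob :: "('s, 'a::finite) mdp \<Rightarrow> 's \<Rightarrow> real ^ 'a \<Rightarrow> 's \<Rightarrow> real" where
  "succ_prob M w y q = (1 / residence M w y) * (\<Sum>a \<in> avail M w. y $ a * trans M w a q)"

definition total_info :: "('s, 'a::finite) mdp \<Rightarrow> 's \<Rightarrow> real ^ 'a \<Rightarrow> ereal" where
  "total_info M w y =
     (if residence M w y = 0 then 0
      else if residence M w y > 0 \<and> (\<exists>q \<in> Succ M w. succ_prob M w y q = 1) then \<infinity>
      else ereal (residence M w y *
             inverse (\<Sum>q \<in> Succ M w. succ_prob M w y q * (1 - succ_prob M w y q))))"

text \<open>
  A family \<open>(x\<^sub>s\<^sub>,\<^sub>a)\<close> indexed by the \<open>s \<notin> C_end M W\<close>, \<open>a \<in> avail M s\<close> is represented by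
  its extension by zero to all pairs.
\<close>

definition decision_space ::
    "('s::finite, 'a::finite) mdp \<Rightarrow> 's set \<Rightarrow> (real ^ 'a ^ 's) set" where
  "decision_space M W = {x. \<forall>s a. s \<in> C_end M W \<or> a \<notin> avail M s \<longrightarrow> x $ s $ a = 0}"

definition nonneg_constraints ::
    "('s::finite, 'a::finite) mdp \<Rightarrow> 's set \<Rightarrow> (real ^ 'a ^ 's) constraint set" where
  "nonneg_constraints M W =
     {Geq (\<lambda>x. x $ s $ a) (\<lambda>_. 0) | s a. s \<notin> C_end M W \<and> a \<in> avail M s}"

definition flow_constraints ::
    "('s::finite, 'a::finite) mdp \<Rightarrow> 's set \<Rightarrow> (real ^ 'a ^ 's) constraint set" where
  "flow_constraints M W =
     {Eq (\<lambda>x. (\<Sum>a \<in> avail M s. x $ s $ a)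
              - (\<Sum>q \<in> - C_end M W. \<Sum>a \<in> avail M q. x $ q $ a * trans M q a s))
         (\<lambda>_. indicator {init M} s) | s. s \<notin> C_end M W}"

definition reach_constraint ::
    "('s::finite, 'a::finite) mdp \<Rightarrow> 's set \<Rightarrow> 's set \<Rightarrow> real \<Rightarrow> (real ^ 'a ^ 's) constraint" where
  "reach_constraint M W C_reach \<nu> =
     Geq (\<lambda>x. \<Sum>q \<in> C_reach. indicator {init M} q
              + (\<Sum>s \<in> - C_end M W. \<Sum>a \<in> avail M s. x $ s $ a * trans M s a q))
         (\<lambda>_. \<nu>)"

definition info_problem ::
    "('s::finite, 'a::finite) mdp \<Rightarrow> 's set \<Rightarrow> 's set \<Rightarrow> real \<Rightarrow> (real ^ 'a ^ 's) opt_problem" where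
  "info_problem M W C_reach \<nu> =
     \<lparr>dom = {x \<in> decision_space M W. \<forall>s a. s \<notin> C_end M W \<and> a \<in> avail M s \<longrightarrow> 0 \<le> x $ s $ a},
      objective = (\<lambda>x. \<Sum>w\<in>W. total_info M w (x $ w)),
      constraints = nonneg_constraints M W \<union> flow_constraints M W
                    \<union> {reach_constraint M W C_reach \<nu>}\<rparr>"

end

theory Submission
  imports Defs
begin

text \<open>
  The constraints are affine by inspection, so the content is the convexity of the objective.

  For a distribution \<open>p\<close> write \<open>D(p) = \<Sum>\<^sub>q p\<^sub>q (1 - p\<^sub>q)\<close>; this is a concave function, and it is positive
  unless \<open>p\<close> is a point mass. Since \<open>t \<mapsto> 1 / t\<close> is convex and decreasing on the positive reals,
  \<open>1 / D(p)\<close>, with value \<open>\<infinity>\<close> at the point masses, is convex. The total information is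
  \<open>F\<^sub>w(y) = x\<^sub>w / D(p)\<close>, where \<open>x\<^sub>w\<close> and \<open>x\<^sub>w p\<close> are linear in \<open>y\<close>: it is the perspective of
  \<open>1 / D\<close> composed with a linear map, and perspectives of convex functions are convex.

  In the form used here, \<open>F\<^sub>w\<close> is homogeneous of degree one (\<open>total_info_scaleR\<close>), because \<open>p\<close> is
  invariant under scaling, and subadditive (\<open>total_info_add_le\<close>), because the successor distribution of
  a sum is the average of the two successor distributions weighted by the residence times.
  Homogeneity and subadditivity give convexity. The observed states avoid \<open>C_end\<close>, so on the domain
  of the problem every \<open>F\<^sub>w\<close> with \<open>w \<in> W\<close> is evaluated at nonnegative residence times, and a sum of
  nonnegative convex functions is convex.
\<close>

section \<open>Gini impurity\<close>

text \<open>The probability that two independent samples of \<open>p\<close> differ.\<close>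

definition gini :: "'q set \<Rightarrow> ('q \<Rightarrow> real) \<Rightarrow> real" where
  "gini Q p = (\<Sum>q\<in>Q. p q * (1 - p q))"

lemma prob_le_1:
  fixes p :: "'q \<Rightarrow> real"
  assumes "finite Q" "\<And>q. q \<in> Q \<Longrightarrow> 0 \<le> p q" "sum p Q = 1" "q \<in> Q"
  shows "p q \<le> 1"
  using member_le_sum[of q Q p] assms by auto

lemma gini_nonneg:
  assumes "finite Q" "\<And>q. q \<in> Q \<Longrightarrow> 0 \<le> p q" "sum p Q = 1"
  shows "0 \<le> gini Q p"
  unfolding gini_def by (intro sum_nonneg mult_nonneg_nonneg) (auto simp: assms prob_le_1[OF assms])

lemma gini_pos:
  assumes "finite Q" "\<And>q. q \<in> Q \<Longrightarrow> 0 \<le> p q" "sum p Q = 1" "\<And>q. q \<in> Q \<Longrightarrow> p q \<noteq> 1"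
  shows "0 < gini Q p"
proof -
  obtain q where q: "q \<in> Q" "p q \<noteq> 0"
    using assms(3) by (metis sum.neutral zero_neq_one)
  have lt: "p r < 1" if "r \<in> Q" for r
    using prob_le_1[OF assms(1-3) that] assms(4)[OF that] by simp
  have "0 < p q * (1 - p q)"
    using q lt[OF q(1)] assms(2)[OF q(1)] by simp
  moreover have "0 \<le> p r * (1 - p r)" if "r \<in> Q" for r
    using lt[OF that] assms(2)[OF that] by simp
  ultimately show ?thesis
    unfolding gini_def by (intro sum_pos2[OF assms(1) q(1)])
qed

lemma gini_concave:
  assumes "0 \<le> u" "0 \<le> v" "u + v = 1"
  shows "u * gini Q p + v * gini Q r \<le> gini Q (\<lambda>q. u * p q + v * r q)"
proof -
  have v: "v = 1 - u" using assms by simp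
  \<comment> \<open>The defect of concavity is the weighted square distance of the two arguments.\<close>
  have "(u * s + v * t) * (1 - (u * s + v * t))
      = u * (s * (1 - s)) + v * (t * (1 - t)) + u * v * (s - t)\<^sup>2" for s t :: real
    unfolding v by algebra
  then show ?thesis
    unfolding gini_def sum_distrib_left sum.distrib[symmetric]
    by (intro sum_mono) (use assms in simp)
qed

section \<open>The perspective of the reciprocal\<close>

text \<open>
  After division by \<open>X + Y\<close> this is the convexity of the reciprocal at the average of \<open>d\<close> and \<open>e\<close>
  with weights proportional to \<open>X\<close> and \<open>Y\<close>.
\<close>

lemma weighted_inverse_le:
  fixes X Y d e z :: real
  assumes "0 < X" "0 < Y" "0 < d" "0 < e"
    and z: "X / (X + Y) * d + Y / (X + Y) * e \<le> z"
  shows "(X + Y) * inverse z \<le> X * inverse d + Y * inverse e"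
proof -
  define u v where "u = X / (X + Y)" and "v = Y / (X + Y)"
  have uv: "0 < u" "0 < v" "u + v = 1"
    using assms by (auto simp: u_def v_def add_divide_distrib[symmetric])
  have scale: "(X + Y) * u = X" "(X + Y) * v = Y"
    using assms by (auto simp: u_def v_def)
  have "0 < u * d + v * e"
    using uv assms by (simp add: add_pos_pos)
  then have "inverse z \<le> inverse (u * d + v * e)"
    using z by (intro le_imp_inverse_le) (auto simp: u_def v_def)
  also have "\<dots> \<le> u * inverse d + v * inverse e"
  proof -
    have u: "u = 1 - v" using uv by simp
    show ?thesis
      unfolding u
      using convex_onD[OF convex_on_inverse[of "{0<..}"], of v d e] uv assms by simp
  qed
  finally have "(X + Y) * inverse z \<le> (X + Y) * (u * inverse d + v * inverse e)"
    using assms by (intro mult_left_mono) auto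
  also have "\<dots> = X * inverse d + Y * inverse e"
    using scale by (simp add: distrib_left mult.assoc[symmetric])
  finally show ?thesis .
qed

section \<open>Total information is sublinear\<close>

definition nonneg_on :: "'a set \<Rightarrow> (real ^ 'a) set" where
  "nonneg_on A = {y. \<forall>a\<in>A. 0 \<le> y $ a}"

lemma convex_nonneg_on: "convex (nonneg_on A)"
  unfolding convex_def nonneg_on_def by auto

lemma residence_nonneg:
  assumes "y \<in> nonneg_on (avail M w)"
  shows "0 \<le> residence M w y"
  using assms unfolding residence_def nonneg_on_def by (auto intro: sum_nonneg)

lemma residence_eq_0:
  fixes M :: "('s, 'a::finite) mdp"
  assumes "y \<in> nonneg_on (avail M w)" "residence M w y = 0" "a \<in> avail M w"
  shows "y $ a = 0"
  using assms unfolding residence_def nonneg_on_def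
  by (subst (asm) sum_nonneg_eq_0_iff) auto

lemma residence_add: "residence M w (y + z) = residence M w y + residence M w z"
  by (simp add: residence_def sum.distrib)

lemma residence_scaleR: "residence M w (c *\<^sub>R y) = c * residence M w y"
  by (simp add: residence_def sum_distrib_left)

lemma succ_prob_nonneg:
  fixes M :: "('s::finite, 'a::finite) mdp"
  assumes "is_mdp M" "y \<in> nonneg_on (avail M w)"
  shows "0 \<le> succ_prob M w y q"
  using assms residence_nonneg[OF assms(2)] unfolding succ_prob_def is_mdp_def nonneg_on_def
  by (auto intro!: mult_nonneg_nonneg sum_nonneg divide_nonneg_nonneg)

lemma sum_succ_prob:
  fixes M :: "('s::finite, 'a::finite) mdp"
  assumes "is_mdp M" "residence M w y \<noteq> 0"
  shows "(\<Sum>q\<in>Succ M w. succ_prob M w y q) = 1"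
proof -
  have row: "(\<Sum>q\<in>Succ M w. trans M w a q) = 1" if a: "a \<in> avail M w" for a
  proof -
    have "(\<Sum>q\<in>Succ M w. trans M w a q) = (\<Sum>q\<in>UNIV. trans M w a q)"
    proof (rule sum.mono_neutral_left)
      show "\<forall>q\<in>UNIV - Succ M w. trans M w a q = 0"
        using assms(1) a unfolding is_mdp_def Succ_def by (force simp: not_less intro: antisym)
    qed auto
    then show ?thesis using assms(1) a unfolding is_mdp_def by simp
  qed
  have "(\<Sum>q\<in>Succ M w. \<Sum>a\<in>avail M w. y $ a * trans M w a q)
      = (\<Sum>a\<in>avail M w. y $ a * (\<Sum>q\<in>Succ M w. trans M w a q))"
    unfolding sum_distrib_left by (rule sum.swap)
  also have "\<dots> = residence M w y"
    unfolding residence_def by (rule sum.cong) (auto simp: row)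
  finally show ?thesis
    using assms(2) by (simp add: succ_prob_def sum_divide_distrib[symmetric])
qed

lemma succ_prob_add:
  assumes "residence M w y > 0" "residence M w z > 0"
  defines "X \<equiv> residence M w y" and "Y \<equiv> residence M w z"
  shows "succ_prob M w (y + z) q
       = X / (X + Y) * succ_prob M w y q + Y / (X + Y) * succ_prob M w z q"
proof -
  have "(\<Sum>a\<in>avail M w. (y + z) $ a * trans M w a q)
      = (\<Sum>a\<in>avail M w. y $ a * trans M w a q) + (\<Sum>a\<in>avail M w. z $ a * trans M w a q)"
    by (simp add: sum.distrib distrib_right)
  then show ?thesis
    using assms(1,2) unfolding succ_prob_def residence_add X_def Y_def
    by (simp add: add_divide_distrib)
qed

lemma succ_prob_scaleR:
  assumes "c \<noteq> 0"
  shows "succ_prob M w (c *\<^sub>R y) q = succ_prob M w y q"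
  using assms by (simp add: succ_prob_def residence_scaleR mult.assoc sum_distrib_left[symmetric])

lemma total_info_gini:
  fixes M :: "('s::finite, 'a::finite) mdp"
  assumes "residence M w y > 0" "\<And>q. q \<in> Succ M w \<Longrightarrow> succ_prob M w y q \<noteq> 1"
  shows "total_info M w y
       = ereal (residence M w y * inverse (gini (Succ M w) (succ_prob M w y)))"
  using assms by (auto simp: total_info_def gini_def)

lemma total_info_nonneg:
  fixes M :: "('s::finite, 'a::finite) mdp"
  assumes "is_mdp M" "y \<in> nonneg_on (avail M w)"
  shows "0 \<le> total_info M w y"
proof (cases "residence M w y = 0")
  case True
  then show ?thesis by (simp add: total_info_def)
next
  case False
  have "0 \<le> gini (Succ M w) (succ_prob M w y)"
    using succ_prob_nonneg[OF assms] sum_succ_prob[OF assms(1) False] by (intro gini_nonneg) auto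
  then show ?thesis
    using residence_nonneg[OF assms(2)] by (auto simp: total_info_def gini_def)
qed

text \<open>
  The case \<open>c = 0\<close> is covered because \<open>0 * \<infinity> = 0\<close> in the extended reals.
\<close>

lemma total_info_scaleR:
  fixes M :: "('s::finite, 'a::finite) mdp"
  assumes "0 \<le> c"
  shows "total_info M w (c *\<^sub>R y) = ereal c * total_info M w y"
proof (cases "c = 0")
  case True
  then show ?thesis by (simp add: total_info_def residence_def zero_ereal_def[symmetric])
next
  case False
  then show ?thesis
    using assms
    by (auto simp: total_info_def residence_scaleR succ_prob_scaleR zero_less_mult_iff)
qed

text \<open>
  If one argument has residence time zero, then its relevant entries vanish and it adds nothing; if one
  has infinite information, the bound is trivial. In the remaining case neither successor
  distribution is a point mass, hence neither is their average, and concavity of the impurity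
  combines with the convexity of the reciprocal.
\<close>

lemma total_info_add_le:
  fixes M :: "('s::finite, 'a::finite) mdp"
  assumes M: "is_mdp M"
    and y: "y \<in> nonneg_on (avail M w)" and z: "z \<in> nonneg_on (avail M w)"
  shows "total_info M w (y + z) \<le> total_info M w y + total_info M w z"
proof -
  have cong: "total_info M w y' = total_info M w z'"
    if "\<forall>a\<in>avail M w. y' $ a = z' $ a" for y' z'
    using that by (simp add: total_info_def residence_def succ_prob_def)
  let ?X = "residence M w y" and ?Y = "residence M w z"
  let ?p = "succ_prob M w y" and ?r = "succ_prob M w z"
  consider "?X = 0" | "?Y = 0"
    | "0 < ?X" "\<exists>q\<in>Succ M w. ?p q = 1"
    | "0 < ?Y" "\<exists>q\<in>Succ M w. ?r q = 1"
    | "0 < ?X" "0 < ?Y" "\<And>q. q \<in> Succ M w \<Longrightarrow> ?p q \<noteq> 1" "\<And>q. q \<in> Succ M w \<Longrightarrow> ?r q \<noteq> 1"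
    using residence_nonneg[OF y] residence_nonneg[OF z] by force
  then show ?thesis
  proof cases
    case 1
    then have "total_info M w (y + z) = total_info M w z"
      using residence_eq_0[OF y] by (intro cong) auto
    then show ?thesis
      using 1 by (simp add: total_info_def[of M w y])
  next
    case 2
    then have "total_info M w (y + z) = total_info M w y"
      using residence_eq_0[OF z] by (intro cong) auto
    then show ?thesis
      using 2 by (simp add: total_info_def[of M w z])
  next
    case 3
    then have "total_info M w y = \<infinity>" by (auto simp: total_info_def)
    then show ?thesis by simp
  next
    case 4
    then have "total_info M w z = \<infinity>" by (auto simp: total_info_def)
    then show ?thesis by simp
  next
    case 5
    define u v where "u = ?X / (?X + ?Y)" and "v = ?Y / (?X + ?Y)"
    have uv: "0 < u" "0 < v" "u + v = 1"
      using 5 by (auto simp: u_def v_def add_divide_distrib[symmetric])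
    have p1: "(\<Sum>q\<in>Succ M w. ?p q) = 1" and r1: "(\<Sum>q\<in>Succ M w. ?r q) = 1"
      using sum_succ_prob[OF M] 5 by auto
    note p0 = succ_prob_nonneg[OF M y] and r0 = succ_prob_nonneg[OF M z]
    have mix: "succ_prob M w (y + z) = (\<lambda>q. u * ?p q + v * ?r q)"
      using succ_prob_add[OF 5(1,2)] by (auto simp: u_def v_def)
    have mix_ne: "succ_prob M w (y + z) q \<noteq> 1" if q: "q \<in> Succ M w" for q
    proof -
      have "?p q < 1" "?r q < 1"
        using prob_le_1[of "Succ M w" ?p, OF _ p0 p1 q] prob_le_1[of "Succ M w" ?r, OF _ r0 r1 q]
          5(3,4)[OF q] by auto
      then have "u * ?p q + v * ?r q < u * 1 + v * 1"
        using uv by (intro add_strict_mono mult_strict_left_mono) auto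
      then show ?thesis using uv by (simp add: mix)
    qed
    have "0 < gini (Succ M w) ?p" "0 < gini (Succ M w) ?r"
      using p0 r0 p1 r1 5 by (auto intro!: gini_pos)
    then have "(?X + ?Y) * inverse (gini (Succ M w) (succ_prob M w (y + z)))
        \<le> ?X * inverse (gini (Succ M w) ?p) + ?Y * inverse (gini (Succ M w) ?r)"
      using 5(1,2) gini_concave[of u v "Succ M w" ?p ?r] uv
      by (intro weighted_inverse_le) (auto simp: mix u_def v_def)
    moreover have "total_info M w y = ereal (?X * inverse (gini (Succ M w) ?p))"
      using 5 by (intro total_info_gini)
    moreover have "total_info M w z = ereal (?Y * inverse (gini (Succ M w) ?r))"
      using 5 by (intro total_info_gini)
    moreover have "total_info M w (y + z)
        = ereal ((?X + ?Y) * inverse (gini (Succ M w) (succ_prob M w (y + z))))"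
      unfolding residence_add[symmetric]
      using 5(1,2) mix_ne by (intro total_info_gini) (simp_all add: residence_add)
    ultimately show ?thesis by simp
  qed
qed

lemma total_info_convex:
  fixes M :: "('s::finite, 'a::finite) mdp"
  assumes M: "is_mdp M"
  shows "ereal_convex_on (nonneg_on (avail M w)) (total_info M w)"
  unfolding ereal_convex_on_def
proof (intro conjI ballI allI impI)
  fix y z :: "real ^ 'a" and u v :: real
  assume yz: "y \<in> nonneg_on (avail M w)" "z \<in> nonneg_on (avail M w)" and uv: "0 \<le> u" "0 \<le> v"
  have "total_info M w (u *\<^sub>R y + v *\<^sub>R z)
      \<le> total_info M w (u *\<^sub>R y) + total_info M w (v *\<^sub>R z)"
    using yz uv by (intro total_info_add_le[OF M]) (auto simp: nonneg_on_def)
  then show "total_info M w (u *\<^sub>R y + v *\<^sub>R z)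
      \<le> ereal u * total_info M w y + ereal v * total_info M w z"
    using uv by (simp add: total_info_scaleR)
qed (rule convex_nonneg_on)

section \<open>Convexity of the objective\<close>

lemma ereal_convex_on_sum:
  assumes "convex S" "\<And>i. i \<in> I \<Longrightarrow> ereal_convex_on S (f i)"
    and nonneg: "\<And>i x. i \<in> I \<Longrightarrow> x \<in> S \<Longrightarrow> 0 \<le> f i x"
  shows "ereal_convex_on S (\<lambda>x. \<Sum>i\<in>I. f i x)"
  unfolding ereal_convex_on_def
proof (intro conjI ballI allI impI)
  fix x y and u v :: real
  assume *: "x \<in> S" "y \<in> S" "0 \<le> u" "0 \<le> v" "u + v = 1"
  have "(\<Sum>i\<in>I. f i (u *\<^sub>R x + v *\<^sub>R y)) \<le> (\<Sum>i\<in>I. ereal u * f i x + ereal v * f i y)"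
    using assms(2) * unfolding ereal_convex_on_def by (intro sum_mono) blast
  also have "\<dots> = ereal u * (\<Sum>i\<in>I. f i x) + ereal v * (\<Sum>i\<in>I. f i y)"
    using nonneg * by (simp add: sum.distrib sum_ereal_right_distrib)
  finally show "(\<Sum>i\<in>I. f i (u *\<^sub>R x + v *\<^sub>R y))
      \<le> ereal u * (\<Sum>i\<in>I. f i x) + ereal v * (\<Sum>i\<in>I. f i y)" .
qed (rule assms(1))

lemma ereal_convex_on_compose_linear:
  assumes "linear h" "ereal_convex_on T f" "convex S" "h ` S \<subseteq> T"
  shows "ereal_convex_on S (\<lambda>x. f (h x))"
  unfolding ereal_convex_on_def
proof (intro conjI ballI allI impI)
  fix x y and u v :: real
  assume "x \<in> S" "y \<in> S" "0 \<le> u" "0 \<le> v" "u + v = 1"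
  then have "f (u *\<^sub>R h x + v *\<^sub>R h y) \<le> ereal u * f (h x) + ereal v * f (h y)"
    using assms(2,4) unfolding ereal_convex_on_def by (simp add: image_subset_iff)
  then show "f (h (u *\<^sub>R x + v *\<^sub>R y)) \<le> ereal u * f (h x) + ereal v * f (h y)"
    by (simp add: linear_add[OF assms(1)] linear_scale[OF assms(1)])
qed (rule assms(3))

lemma not_in_C_end:
  assumes "w \<in> W"
  shows "w \<notin> C_end M W"
  using assms unfolding C_end_def umec_def uec_def by blast

lemma convex_dom_info_problem: "convex (dom (info_problem M W C_reach \<nu>))"
  unfolding convex_def info_problem_def decision_space_def by auto

lemma objective_info_problem_convex:
  fixes M :: "('s::finite, 'a::finite) mdp"
  assumes M: "is_mdp M"
  shows "ereal_convex_on (dom (info_problem M W C_reach \<nu>)) (objective (info_problem M W C_reach \<nu>))"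
    (is "ereal_convex_on ?S _")
proof -
  have mem: "x $ w \<in> nonneg_on (avail M w)" if "w \<in> W" "x \<in> ?S" for w x
    using that not_in_C_end[OF that(1)] by (auto simp: info_problem_def nonneg_on_def)
  have "ereal_convex_on ?S (\<lambda>x. \<Sum>w\<in>W. total_info M w (x $ w))"
  proof (rule ereal_convex_on_sum[OF convex_dom_info_problem])
    fix w assume w: "w \<in> W"
    show "ereal_convex_on ?S (\<lambda>x. total_info M w (x $ w))"
      by (rule ereal_convex_on_compose_linear[OF _ total_info_convex[OF M] convex_dom_info_problem])
        (use mem w in \<open>auto simp: linear_iff\<close>)
  next
    fix w x assume "w \<in> W" "x \<in> ?S"
    then show "0 \<le> total_info M w (x $ w)"
      by (intro total_info_nonneg[OF M] mem)
  qed
  then show ?thesis by (simp add: info_problem_def)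
qed

section \<open>The constraints\<close>

lemma affine_function_const: "affine_function (\<lambda>_. c)"
  unfolding affine_function_def by (rule exI[of _ "\<lambda>_. 0"]) (auto simp: linear_iff)

lemma affine_function_linear: "linear f \<Longrightarrow> affine_function f"
  unfolding affine_function_def by (intro exI[of _ f] exI[of _ 0]) auto

lemma affine_function_add:
  assumes "affine_function f" "affine_function g"
  shows "affine_function (\<lambda>x. f x + g x)"
proof -
  obtain L c L' c' where "linear L" "\<And>x. f x = L x + c" "linear L'" "\<And>x. g x = L' x + c'"
    using assms unfolding affine_function_def by blast
  then show ?thesis
    unfolding affine_function_def
    by (intro exI[of _ "\<lambda>x. L x + L' x"] exI[of _ "c + c'"]) (auto intro: linear_compose_add)
qed

lemma affine_function_sum:
  assumes "\<And>i. i \<in> I \<Longrightarrow> affine_function (f i)"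
  shows "affine_function (\<lambda>x. \<Sum>i\<in>I. f i x)"
  using assms
  by (induction I rule: infinite_finite_induct)
    (auto intro: affine_function_const affine_function_add)

lemma affine_function_scale:
  assumes "affine_function f"
  shows "affine_function (\<lambda>x. f x * c)"
proof -
  obtain L d where "linear L" "\<And>x. f x = L x + d"
    using assms unfolding affine_function_def by blast
  then show ?thesis
    unfolding affine_function_def
    by (intro exI[of _ "\<lambda>x. L x * c"] exI[of _ "d * c"]) (auto simp: linear_iff algebra_simps)
qed

lemma affine_function_diff:
  assumes "affine_function f" "affine_function g"
  shows "affine_function (\<lambda>x. f x - g x)"
  using affine_function_add[OF assms(1) affine_function_scale[OF assms(2), of "-1"]] by simp

lemma affine_function_entry: "affine_function (\<lambda>x :: real ^ 'a ^ 's. x $ s $ a)"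
  by (rule affine_function_linear) (auto simp: linear_iff)

lemmas affine_function_intros =
  affine_function_const affine_function_entry affine_function_sum affine_function_scale
  affine_function_diff affine_function_add

lemma finite_constraints_info_problem: "finite (constraints (info_problem M W C_reach \<nu>))"
proof -
  have "nonneg_constraints M W \<subseteq> (\<lambda>(s, a). Geq (\<lambda>x. x $ s $ a) (\<lambda>_. 0)) ` UNIV"
    unfolding nonneg_constraints_def by auto
  then have "finite (nonneg_constraints M W)"
    by (rule finite_subset) simp
  then show ?thesis
    by (simp add: info_problem_def flow_constraints_def finite_image_set)
qed

lemma affine_constraints_info_problem:
  assumes "c \<in> constraints (info_problem M W C_reach \<nu>)"
  shows "affine_constraint c"
proof -
  consider "c \<in> nonneg_constraints M W" | "c \<in> flow_constraints M W" | "c = reach_constraint M W C_reach \<nu>"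
    using assms unfolding info_problem_def by auto
  then show ?thesis
  proof cases
    case 1
    then obtain s a where c: "c = Geq (\<lambda>x. x $ s $ a) (\<lambda>_. 0)"
      unfolding nonneg_constraints_def by blast
    show ?thesis
      unfolding c affine_constraint.simps by (intro conjI affine_function_intros)
  next
    case 2
    then obtain s where c: "c = Eq (\<lambda>x. (\<Sum>a \<in> avail M s. x $ s $ a)
          - (\<Sum>q \<in> - C_end M W. \<Sum>a \<in> avail M q. x $ q $ a * trans M q a s))
        (\<lambda>_. indicator {init M} s)"
      unfolding flow_constraints_def by blast
    show ?thesis
      unfolding c affine_constraint.simps by (intro conjI affine_function_intros)
  next
    case 3
    show ?thesis
      unfolding 3 reach_constraint_def affine_constraint.simps
      by (intro conjI affine_function_intros)
  qed
qed

section \<open>The convex problem\<close>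

theorem proposition3:
  fixes M :: "('s::finite, 'a::finite) mdp"
    and W C_reach :: "'s set"
    and \<nu>_reach :: real
  assumes "is_mdp M"
    and "\<forall>q \<in> C_reach. absorbing M q \<and> q \<notin> W"
    and "0 \<le> \<nu>_reach" and "\<nu>_reach \<le> 1"
    and "\<forall>C D. umec M W C D \<longrightarrow> closed_component M C"
  shows "convex_problem (info_problem M W C_reach \<nu>_reach)"
  unfolding convex_problem_def
  using objective_info_problem_convex[OF assms(1)] finite_constraints_info_problem
    affine_constraints_info_problem by blast

end
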